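(* Let $R$ be an integral domain containing $\mathbb{Q}$, let $\alpha\in R$, and let $n\ge0$ and $N\ge3$ be integers. Consider the differential equation $$(\alpha-Y^2)\,q''(Y)-(N-1)Y\,q'(Y)+n(n+N-2)\,q(Y)=0.\qquad( * )$$ (a) Every nonzero $q(Y)\in R[Y]$ satisfying $( * )$ has degree $n$. (b) If $\alpha=0$, then $q(Y)=Y^n$ is a solution of $( * )$, and it is the unique solution in $R[Y]$ up to multiplication by elements of $R$. (c) If $\alpha\ne0$, then there exists a nonzero solution $q(Y)$ of $( * )$ with coefficients in $R[\alpha^{-1}]$, unique up to scaling by elements of $R$ in the sense that every polynomial in $R[Y]$ satisfying $( * )$ is an $R$-multiple of it; this solution is an even polynomial if $n$ is even and an odd polynomial if $n$ is odd.
   Context: $R[\alpha^{-1}]$ is the subring of the fraction field of $R$ generated by $R$ and $\alpha^{-1}$. An even (odd) polynomial is one containing only even (odd) powers of $Y$. *)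

theory Defs
  imports "HOL-Computational_Algebra.Computational_Algebra"
begin

definition contains_rationals :: "'a::idom itself \<Rightarrow> bool" where
  "contains_rationals T \<longleftrightarrow>
     (\<exists>\<phi> :: rat \<Rightarrow> 'a. inj \<phi> \<and> \<phi> 1 = 1 \<and>
        (\<forall>x y. \<phi> (x + y) = \<phi> x + \<phi> y) \<and> (\<forall>x y. \<phi> (x * y) = \<phi> x * \<phi> y))"

(* The variable Y is [:0, 1:].  The integers N - 1 and n + N - 2 are computed in the
   coefficient ring, so there is no truncated subtraction. *)
definition satisfies_ode :: "'a::idom \<Rightarrow> nat \<Rightarrow> nat \<Rightarrow> 'a poly \<Rightarrow> bool" where
  "satisfies_ode \<alpha> n N q \<longleftrightarrow>
     ([:\<alpha>:] - [:0, 1:] ^ 2) * pderiv (pderiv q)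
       - smult (of_nat N - 1) ([:0, 1:] * pderiv q)
       + smult (of_nat n * (of_nat n + of_nat N - 2)) q = 0"

definition is_subring :: "'a::ring_1 set \<Rightarrow> bool" where
  "is_subring S \<longleftrightarrow> 1 \<in> S \<and> (\<forall>x\<in>S. \<forall>y\<in>S. x - y \<in> S \<and> x * y \<in> S)"

(* R[1/alpha] inside the fraction field of R; only meaningful for nonzero alpha. *)
definition adjoin_inverse :: "'a::idom \<Rightarrow> 'a fract set" where
  "adjoin_inverse \<alpha> = is_subring hull (insert (inverse (to_fract \<alpha>)) (range to_fract))"

definition even_poly :: "'a::zero poly \<Rightarrow> bool" where
  "even_poly p \<longleftrightarrow> (\<forall>k. coeff p k \<noteq> 0 \<longrightarrow> even k)"

definition odd_poly :: "'a::zero poly \<Rightarrow> bool" where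
  "odd_poly p \<longleftrightarrow> (\<forall>k. coeff p k \<noteq> 0 \<longrightarrow> odd k)"

end

(* Comparing coefficients of Y^k turns the equation into the two-term recurrence
     alpha (k+2) (k+1) c_{k+2} + (n-k) (n+k+N-2) c_k = 0.
   At k = deg q it forces deg q = n.  Started from c_n = 1 and c_{n+1} = 0 and run downwards it
   only divides by positive integers, so it yields a monic solution q of degree n over R itself,
   whether or not alpha vanishes.  For any solution p the difference p - c_n(p) q is a
   solution without Y^n term, hence zero by the degree statement. *)
theory Submission
  imports Defs
begin

text \<open>The image of 1/m under the embedding of the rationals is an inverse of m. This is the
  form in which the hypothesis enters later: \<open>u\<close> supplies the divisions in the
  recurrence, and its existence shows that positive integers are nonzero in R.\<close>

lemma contains_rationals_of_nat_inverse:
  assumes "contains_rationals TYPE('a::idom)"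
  obtains u :: "nat \<Rightarrow> 'a::idom" where "\<And>m. m > 0 \<Longrightarrow> of_nat m * u m = 1"
proof -
  obtain \<phi> :: "rat \<Rightarrow> 'a" where one: "\<phi> 1 = 1"
    and add: "\<And>x y. \<phi> (x + y) = \<phi> x + \<phi> y" and mult: "\<And>x y. \<phi> (x * y) = \<phi> x * \<phi> y"
    using assms unfolding contains_rationals_def by blast
  have zero: "\<phi> 0 = 0"
    by (metis add add_cancel_right_right)
  have of_nat: "\<phi> (of_nat m) = of_nat m" for m
    by (induction m) (simp_all add: zero add one)
  have "of_nat m * \<phi> (inverse (of_nat m)) = 1" if "m > 0" for m
    using that by (simp add: of_nat[symmetric] mult[symmetric] one)
  then show thesis
    by (rule that)
qed

lemma satisfies_ode_iff_recurrence:
  fixes \<alpha> :: "'a::idom"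
  shows "satisfies_ode \<alpha> n N q \<longleftrightarrow>
    (\<forall>k. \<alpha> * of_nat ((k + 2) * (k + 1)) * coeff q (k + 2)
       + (of_nat n - of_nat k) * (of_nat (n + k + N) - 2) * coeff q k = 0)"
proof -
  have "coeff (([:\<alpha>:] - [:0, 1:] ^ 2) * pderiv (pderiv q)
       - smult (of_nat N - 1) ([:0, 1:] * pderiv q)
       + smult (of_nat n * (of_nat n + of_nat N - 2)) q) k =
     \<alpha> * of_nat ((k + 2) * (k + 1)) * coeff q (k + 2)
       + (of_nat n - of_nat k) * (of_nat (n + k + N) - 2) * coeff q k" for k
  proof -
    \<comment> \<open>Multiplication by Y and by Y^2 shifts coefficients by one and two places, so
      the two lowest indices are separate. The factored form comes from n(n+N-2) - k(k-1) - (N-1)k =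
      (n-k)(n+k+N-2).\<close>
    consider "k = 0" | "k = 1" | j where "k = Suc (Suc j)"
      by (metis One_nat_def not0_implies_Suc)
    then show ?thesis
      by cases (simp_all add: coeff_pderiv power2_eq_square left_diff_distrib[of "[:\<alpha>:]"]
          algebra_simps)
  qed
  then show ?thesis
    by (simp add: satisfies_ode_def poly_eq_iff)
qed

lemma satisfies_ode_diff:
  assumes "satisfies_ode \<alpha> n N p" "satisfies_ode \<alpha> n N q"
  shows "satisfies_ode \<alpha> n N (p - smult r q)"
proof -
  let ?L = "\<lambda>p k. \<alpha> * of_nat ((k + 2) * (k + 1)) * coeff p (k + 2)
       + (of_nat n - of_nat k) * (of_nat (n + k + N) - 2) * coeff p k"
  have "?L (p - smult r q) k = ?L p k - r * ?L q k" for k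
    by (simp only: coeff_diff coeff_smult) (simp only: algebra_simps)
  with assms show ?thesis
    unfolding satisfies_ode_iff_recurrence by simp
qed

text \<open>The recurrence is a family of identities in R, and the ring homomorphism
  \<open>to_fract\<close> preserves each of them. This carries a solution over R to the fraction
  field, where the last claim of the theorem is stated.\<close>

lemma satisfies_ode_fract_poly:
  assumes "satisfies_ode \<alpha> n N p"
  shows "satisfies_ode (to_fract \<alpha>) n N (fract_poly p)"
  unfolding satisfies_ode_iff_recurrence
proof
  fix k
  have of_nat: "to_fract (of_nat m :: 'a) = of_nat m" for m
    by (induction m) simp_all
  have two: "to_fract (2::'a) = 2"
    using of_nat[of 2] by simp
  have "to_fract (\<alpha> * of_nat ((k + 2) * (k + 1)) * coeff p (k + 2)
       + (of_nat n - of_nat k) * (of_nat (n + k + N) - 2) * coeff p k) = 0"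
    using assms unfolding satisfies_ode_iff_recurrence by simp
  then show "to_fract \<alpha> * of_nat ((k + 2) * (k + 1)) * coeff (fract_poly p) (k + 2)
       + (of_nat n - of_nat k) * (of_nat (n + k + N) - 2) * coeff (fract_poly p) k = 0"
    by (simp only: to_fract_add to_fract_mult to_fract_diff of_nat coeff_map_poly to_fract_0
        two)
qed

text \<open>At the top index d the term with \<open>\<alpha>\<close> vanishes, leaving
  (n-d)(n+d+N-2) times the leading coefficient. For N at least 3 the second factor is a positive
  integer, hence nonzero in R, so n = d.\<close>

lemma satisfies_ode_degree:
  fixes q :: "'a::idom poly"
  assumes char: "\<And>m. m > 0 \<Longrightarrow> of_nat m \<noteq> (0::'a)"
    and "N \<ge> 3" "satisfies_ode \<alpha> n N q" "q \<noteq> 0"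
  shows "degree q = n"
proof (rule ccontr)
  let ?d = "degree q"
  assume ne: "?d \<noteq> n"
  have "(of_nat n - of_nat ?d) * (of_nat (n + ?d + N) - 2) * coeff q ?d = 0"
    using assms(3)[unfolded satisfies_ode_iff_recurrence, rule_format, of ?d]
    by (simp add: coeff_eq_0)
  moreover have "of_nat (n + ?d + N) - 2 = (of_nat (n + ?d + N - 2) :: 'a)"
    using \<open>N \<ge> 3\<close> by (simp add: of_nat_diff)
  moreover have "of_nat (n + ?d + N - 2) \<noteq> (0::'a)"
    using \<open>N \<ge> 3\<close> by (intro char) simp
  moreover have "of_nat n - of_nat ?d \<noteq> (0::'a)"
  \<comment> \<open>Natural subtraction truncates, so the difference is written as plus or minus
    \<open>of_nat\<close> of a positive number, depending on which of the two is larger.\<close>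
  proof (cases "n < ?d")
    case True
    then show ?thesis
      using char[of "?d - n"] by (simp add: of_nat_diff)
  next
    case False
    then show ?thesis
      using char[of "n - ?d"] ne by (simp add: of_nat_diff)
  qed
  ultimately show False
    using \<open>q \<noteq> 0\<close> by simp
qed

(* The i-th value is the coefficient of Y^(n-i); u is meant to invert positive integers. *)
fun descending_coeff :: "(nat \<Rightarrow> 'a::idom) \<Rightarrow> 'a \<Rightarrow> nat \<Rightarrow> nat \<Rightarrow> nat \<Rightarrow> 'a" where
  "descending_coeff u \<alpha> n N 0 = 1"
| "descending_coeff u \<alpha> n N (Suc 0) = 0"
| "descending_coeff u \<alpha> n N (Suc (Suc i)) =
     - \<alpha> * of_nat ((n - i) * (n - i - 1)) * u ((i + 2) * (2 * n + N - i - 4))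
       * descending_coeff u \<alpha> n N i"

text \<open>The recursion moves in steps of two and the odd chain starts at 0. As index i belongs to
  Y^(n-i), only powers with the parity of n survive.\<close>

lemma descending_coeff_odd: "odd i \<Longrightarrow> descending_coeff u \<alpha> n N i = 0"
  by (induction u \<alpha> n N i rule: descending_coeff.induct) simp_all

lemma ex_monic_solution:
  fixes \<alpha> :: "'a::idom"
  assumes u: "\<And>m. m > 0 \<Longrightarrow> of_nat m * u m = (1::'a)" and "N \<ge> 3"
  obtains q where "satisfies_ode \<alpha> n N q" "coeff q n = 1"
    "\<And>k. coeff q k \<noteq> 0 \<Longrightarrow> even k \<longleftrightarrow> even n"
proof
  let ?c = "descending_coeff u \<alpha> n N"
  define q where "q = (\<Sum>k\<le>n. monom (?c (n - k)) k)"
  have coeff_q: "coeff q k = (if k \<le> n then ?c (n - k) else 0)" for k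
    by (simp add: q_def coeff_sum)
  show "coeff q n = 1"
    by (simp add: coeff_q)
  show "even k \<longleftrightarrow> even n" if "coeff q k \<noteq> 0" for k
    using that descending_coeff_odd[of "n - k" u \<alpha> n N]
    by (auto simp: coeff_q split: if_splits)
  show "satisfies_ode \<alpha> n N q"
    unfolding satisfies_ode_iff_recurrence
  proof
    fix k
    \<comment> \<open>In the first three cases both terms vanish: \<open>coeff q (k + 2)\<close>
      lies above the top index n, and either \<open>coeff q k\<close> is 0 or the factor n - k is.
      Only the last case uses the recursion.\<close>
    consider "k > n" | "k = n" | "n = Suc k" | i where "n = k + i + 2"
      by (metis add_2_eq_Suc' add_Suc_right less_imp_Suc_add linorder_neqE_nat old.nat.exhaust
          add.right_neutral)
    then show "\<alpha> * of_nat ((k + 2) * (k + 1)) * coeff q (k + 2)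
       + (of_nat n - of_nat k) * (of_nat (n + k + N) - 2) * coeff q k = 0"
    proof cases
      case (4 i)
      \<comment> \<open>Substituting n = k + i + 2 gives n - i = k + 2, so \<open>A\<close> is the
        integer in the numerator of the recursion step. The divisor is \<open>M\<close>, which
        equals (n-k)(n+k+N-2) and is positive, hence inverted by \<open>u M\<close>.\<close>
      define A where "A = (of_nat ((k + 2) * (k + 1)) :: 'a)"
      define M where "M = (i + 2) * (2 * n + N - i - 4)"
      have "M > 0"
        using 4 \<open>N \<ge> 3\<close> by (simp add: M_def)
      have "n + k + N - 2 = 2 * n + N - i - 4"
        using 4 by simp
      then have "(of_nat n - of_nat k) * (of_nat (n + k + N) - 2) = (of_nat M :: 'a)"
        using 4 \<open>N \<ge> 3\<close> of_nat_diff[of 2 "n + k + N", where ?'a = 'a]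
        by (simp add: M_def del: of_nat_add) (simp add: algebra_simps)
      moreover have "coeff q k = - \<alpha> * A * u M * ?c i"
        using 4 by (simp add: coeff_q A_def M_def del: of_nat_mult)
      moreover have "coeff q (k + 2) = ?c i"
        using 4 by (simp add: coeff_q)
      moreover have "\<alpha> * A * ?c i + of_nat M * (- \<alpha> * A * u M * ?c i) =
          \<alpha> * A * ?c i * (1 - of_nat M * u M)"
        by (simp add: algebra_simps)
      ultimately show ?thesis
        using u[OF \<open>M > 0\<close>] by (simp only: A_def[symmetric]) simp
    qed (simp_all add: coeff_q)
  qed
qed

lemma to_fract_in_adjoin_inverse: "to_fract x \<in> adjoin_inverse \<alpha>"
  unfolding adjoin_inverse_def by (rule hull_inc) simp

lemma satisfies_ode_zero_monom: "satisfies_ode 0 n N (monom 1 n)"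
  by (simp add: satisfies_ode_iff_recurrence)

theorem proposition5p9:
  fixes \<alpha> :: "'a::idom" and n N :: nat
  assumes "contains_rationals TYPE('a)"
    and "N \<ge> 3"
  shows "(\<forall>q::'a poly. q \<noteq> 0 \<and> satisfies_ode \<alpha> n N q \<longrightarrow> degree q = n) \<and>
    (\<alpha> = 0 \<longrightarrow>
       satisfies_ode \<alpha> n N (monom 1 n) \<and>
       (\<forall>q::'a poly. satisfies_ode \<alpha> n N q \<longrightarrow> (\<exists>r. q = smult r (monom 1 n)))) \<and>
    (\<alpha> \<noteq> 0 \<longrightarrow>
       (\<exists>q::'a fract poly. q \<noteq> 0 \<and> satisfies_ode (to_fract \<alpha>) n N q \<and>
          (\<forall>k. coeff q k \<in> adjoin_inverse \<alpha>) \<and>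
          (\<forall>p::'a poly. satisfies_ode \<alpha> n N p \<longrightarrow>
             (\<exists>r::'a. fract_poly p = smult (to_fract r) q)) \<and>
          (even n \<longrightarrow> even_poly q) \<and> (odd n \<longrightarrow> odd_poly q)))"
proof -
  obtain u :: "nat \<Rightarrow> 'a" where u: "\<And>m. m > 0 \<Longrightarrow> of_nat m * u m = 1"
    using contains_rationals_of_nat_inverse[OF assms(1)] by blast
  have char: "of_nat m \<noteq> (0::'a)" if "m > 0" for m
    using u[OF that] by auto
  note deg = satisfies_ode_degree[OF char \<open>N \<ge> 3\<close>]
  have unique: "p = smult (coeff p n) q"
    if "satisfies_ode \<alpha> n N p" "satisfies_ode \<alpha> n N q" "coeff q n = 1" for p q :: "'a poly"
  proof (rule ccontr)
    let ?d = "p - smult (coeff p n) q"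
    assume "p \<noteq> smult (coeff p n) q"
    then have "?d \<noteq> 0"
      by simp
    moreover from this have "degree ?d = n"
      using deg satisfies_ode_diff that by blast
    moreover have "coeff ?d n = 0"
      using that by simp
    ultimately show False
      by (metis leading_coeff_0_iff)
  qed
  obtain q where q: "satisfies_ode \<alpha> n N q" "coeff q n = 1"
    and parity: "\<And>k. coeff q k \<noteq> 0 \<Longrightarrow> even k \<longleftrightarrow> even n"
    using ex_monic_solution[OF u \<open>N \<ge> 3\<close>] by blast
  have "\<forall>q::'a poly. q \<noteq> 0 \<and> satisfies_ode \<alpha> n N q \<longrightarrow> degree q = n"
    using deg by blast
  moreover have "satisfies_ode \<alpha> n N (monom 1 n) \<and>
       (\<forall>q::'a poly. satisfies_ode \<alpha> n N q \<longrightarrow> (\<exists>r. q = smult r (monom 1 n)))" if "\<alpha> = 0"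
  proof (intro conjI allI impI)
    show "satisfies_ode \<alpha> n N (monom 1 n)"
      using that satisfies_ode_zero_monom by simp
    \<comment> \<open>The monomial is itself a solution with coefficient 1 at Y^n, so it can serve
      as the reference solution in \<open>unique\<close>.\<close>
    then show "\<exists>r. p = smult r (monom 1 n)" if "satisfies_ode \<alpha> n N p" for p
      using unique[OF that, of "monom 1 n"] by auto
  qed
  moreover have "\<exists>q::'a fract poly. q \<noteq> 0 \<and> satisfies_ode (to_fract \<alpha>) n N q \<and>
          (\<forall>k. coeff q k \<in> adjoin_inverse \<alpha>) \<and>
          (\<forall>p::'a poly. satisfies_ode \<alpha> n N p \<longrightarrow>
             (\<exists>r::'a. fract_poly p = smult (to_fract r) q)) \<and>
          (even n \<longrightarrow> even_poly q) \<and> (odd n \<longrightarrow> odd_poly q)"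
  \<comment> \<open>The witness is the image of the monic solution over R, so its coefficients lie
    in the image of R inside \<open>adjoin_inverse \<alpha>\<close>. The scalar r for a solution p
    is \<open>coeff p n\<close>, an element of R.\<close>
  proof (intro exI[of _ "fract_poly q"] conjI allI impI)
    show "fract_poly q \<noteq> 0"
      using q(2) by auto
    show "satisfies_ode (to_fract \<alpha>) n N (fract_poly q)"
      using q(1) by (rule satisfies_ode_fract_poly)
    show "coeff (fract_poly q) k \<in> adjoin_inverse \<alpha>" for k
      by (simp add: coeff_map_poly to_fract_in_adjoin_inverse)
    show "\<exists>r. fract_poly p = smult (to_fract r) (fract_poly q)"
      if "satisfies_ode \<alpha> n N p" for p
      using unique[OF that q] by (metis fract_poly_smult)
    show "even_poly (fract_poly q)" if "even n"
      using parity that by (auto simp: even_poly_def coeff_map_poly)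
    show "odd_poly (fract_poly q)" if "odd n"
      using parity that by (auto simp: odd_poly_def coeff_map_poly)
  qed
  ultimately show ?thesis
    by blast
qed

end
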